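(* Let $n$ be a positive integer. Then $\mathcal{R}(K_n\,\square\,K_n)$ is isomorphic to the graph obtained from two disjoint copies of the $n$-fold Cartesian product $K_n\,\square\,\cdots\,\square\,K_n$ by identifying, for every permutation vertex, its copy in the first product with its copy in the second product.
   Context: All graphs are finite, simple and undirected; $N(v)$ denotes the open neighbourhood of $v$. A set $S\subseteq V(G)$ is a dominating set if every vertex of $G$ is in $S$ or adjacent to a vertex of $S$; it is a minimal dominating set if no proper subset of $S$ is a dominating set. The reconfiguration graph $\mathcal{R}(G)$ has as vertex set the collection of all minimal dominating sets of $G$, and two minimal dominating sets $M_1,M_2$ are adjacent iff there is a vertex $v$ with either ($M_2\setminus M_1=\{v\}$ and $M_1\setminus M_2\subseteq N(v)$) or ($M_1\setminus M_2=\{v\}$ and $M_2\setminus M_1\subseteq N(v)$). The Cartesian product $A\,\square\,B$ has vertex set $V(A)\times V(B)$ with $(a,b)\sim(a',b')$ iff either $a=a'$ and $b\sim b'$, or $b=b'$ and $a\sim a'$. The $n$-fold product $K_n\,\square\cdots\square\,K_n$ has vertices the $n$-tuples $(v_1,\ldots,v_n)$ with $1\le v_i\le n$, two tuples adjacent iff they differ in exactly one coordinate. A permutation vertex is a tuple with $\{v_1,\ldots,v_n\}=\{1,\ldots,n\}$.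
   Formalization: Each permutation vertex p of the first product is identified with its inverse permutation p⁻¹ in the second product, not with the same tuple p; identifying equal tuples gives a non-isomorphic graph already for n = 3 (the two agree for n ≤ 2). *)

theory Defs
  imports "Graph_Theory.Graph_Theory" "HOL-Library.FuncSet"
begin

text \<open>
  A finite simple undirected graph is a \<^typ>\<open>'a pair_pre_digraph\<close> satisfying
  \<^const>\<open>pair_graph\<close>: finite, loop-free, with a symmetric arc relation.
\<close>

definition neighbourhood :: "'a pair_pre_digraph \<Rightarrow> 'a \<Rightarrow> 'a set" where
  "neighbourhood G v = {u. (v, u) \<in> parcs G}"

definition dominating_set :: "'a pair_pre_digraph \<Rightarrow> 'a set \<Rightarrow> bool" where
  "dominating_set G S \<longleftrightarrow>
     S \<subseteq> pverts G \<and> (\<forall>v\<in>pverts G. v \<in> S \<or> (\<exists>u\<in>S. (u, v) \<in> parcs G))"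

definition minimal_dominating_set :: "'a pair_pre_digraph \<Rightarrow> 'a set \<Rightarrow> bool" where
  "minimal_dominating_set G S \<longleftrightarrow>
     dominating_set G S \<and> (\<forall>T. T \<subset> S \<longrightarrow> \<not> dominating_set G T)"

definition reconf_graph :: "'a pair_pre_digraph \<Rightarrow> 'a set pair_pre_digraph" where
  "reconf_graph G =
     \<lparr> pverts = {M. minimal_dominating_set G M},
       parcs = {(M1, M2). minimal_dominating_set G M1 \<and> minimal_dominating_set G M2 \<and>
         (\<exists>v. (M2 - M1 = {v} \<and> M1 - M2 \<subseteq> neighbourhood G v) \<or>
              (M1 - M2 = {v} \<and> M2 - M1 \<subseteq> neighbourhood G v))} \<rparr>"

definition complete_graph :: "nat \<Rightarrow> nat pair_pre_digraph" where
  "complete_graph n =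
     \<lparr> pverts = {1..n}, parcs = {(u, v). u \<in> {1..n} \<and> v \<in> {1..n} \<and> u \<noteq> v} \<rparr>"

definition cart_prod ::
    "'a pair_pre_digraph \<Rightarrow> 'b pair_pre_digraph \<Rightarrow> ('a \<times> 'b) pair_pre_digraph"
    (infixr \<open>\<box>\<close> 80) where
  "A \<box> B =
     \<lparr> pverts = pverts A \<times> pverts B,
       parcs = {((a, b), (a', b')).
         (a = a' \<and> a \<in> pverts A \<and> (b, b') \<in> parcs B) \<or>
         (b = b' \<and> b \<in> pverts B \<and> (a, a') \<in> parcs A)} \<rparr>"

text \<open>
  The \<open>n\<close>-fold product; an \<open>n\<close>-tuple is an extensional function on \<open>{1..n}\<close>.
\<close>

definition cart_power :: "'a pair_pre_digraph \<Rightarrow> nat \<Rightarrow> (nat \<Rightarrow> 'a) pair_pre_digraph" where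
  "cart_power G n =
     \<lparr> pverts = {1..n} \<rightarrow>\<^sub>E pverts G,
       parcs = {(f, g). f \<in> {1..n} \<rightarrow>\<^sub>E pverts G \<and> g \<in> {1..n} \<rightarrow>\<^sub>E pverts G \<and>
         (\<exists>i\<in>{1..n}. (f i, g i) \<in> parcs G \<and> (\<forall>j\<in>{1..n} - {i}. f j = g j))} \<rparr>"

lemma cart_power_complete_graph_arcs:
  "(f, g) \<in> parcs (cart_power (complete_graph n) n) \<longleftrightarrow>
     f \<in> {1..n} \<rightarrow>\<^sub>E {1..n} \<and> g \<in> {1..n} \<rightarrow>\<^sub>E {1..n} \<and> (\<exists>!i. i \<in> {1..n} \<and> f i \<noteq> g i)"
proof -
  have verts: "pverts (complete_graph n) = {1..n}"
    by (simp add: complete_graph_def)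
  show ?thesis
  proof (cases "f \<in> {1..n} \<rightarrow>\<^sub>E {1..n} \<and> g \<in> {1..n} \<rightarrow>\<^sub>E {1..n}")
    case True
    have arc: "(f i, g i) \<in> parcs (complete_graph n) \<longleftrightarrow> f i \<noteq> g i" if "i \<in> {1..n}" for i
      using True that by (auto simp: complete_graph_def dest!: PiE_mem[OF _ that])
    have "(f, g) \<in> parcs (cart_power (complete_graph n) n) \<longleftrightarrow>
        (\<exists>i\<in>{1..n}. f i \<noteq> g i \<and> (\<forall>j\<in>{1..n} - {i}. f j = g j))"
      using True arc by (simp add: cart_power_def verts)
    also have "\<dots> \<longleftrightarrow> (\<exists>!i. i \<in> {1..n} \<and> f i \<noteq> g i)"
      by (metis Diff_iff singletonD singletonI)
    finally show ?thesis using True by simp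
  next
    case False
    then show ?thesis by (auto simp: cart_power_def verts)
  qed
qed

definition disjoint_union ::
    "'a pair_pre_digraph \<Rightarrow> 'b pair_pre_digraph \<Rightarrow> ('a + 'b) pair_pre_digraph" where
  "disjoint_union A B =
     \<lparr> pverts = Inl ` pverts A \<union> Inr ` pverts B,
       parcs = {(Inl a, Inl a') |a a'. (a, a') \<in> parcs A} \<union>
               {(Inr b, Inr b') |b b'. (b, b') \<in> parcs B} \<rparr>"

text \<open>
  Identification of the pairs of vertices in \<open>r\<close>: the quotient by the equivalence
  relation generated by \<open>r\<close>.
\<close>

definition identify_verts ::
    "'a pair_pre_digraph \<Rightarrow> ('a \<times> 'a) set \<Rightarrow> 'a set pair_pre_digraph" where
  "identify_verts G r =
     (let R = (r \<union> r\<inverse>)\<^sup>* in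
     \<lparr> pverts = pverts G // R,
       parcs = {(R `` {u}, R `` {v}) |u v. (u, v) \<in> parcs G \<and> R `` {u} \<noteq> R `` {v}} \<rparr>)"

definition permutation_vertex :: "nat \<Rightarrow> (nat \<Rightarrow> nat) \<Rightarrow> bool" where
  "permutation_vertex n p \<longleftrightarrow> p \<in> {1..n} \<rightarrow>\<^sub>E {1..n} \<and> p ` {1..n} = {1..n}"

text \<open>
  The first product lists, for every row of \<open>K\<^sub>n \<box> K\<^sub>n\<close>, a column; the second one
  lists, for every column, a row.  Thus the set \<open>{(i, p i) | i}\<close> given by a
  permutation \<open>p\<close> appears as the tuple \<open>p\<close> in the first product and as the tuple
  \<open>p\<inverse>\<close> in the second one, and these are the two copies that are identified.
  The inverse cannot be omitted: for \<open>n = 3\<close>, identifying equal tuples yields a graph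
  that is not isomorphic to the reconfiguration graph.
\<close>

definition inverse_tuple :: "nat \<Rightarrow> (nat \<Rightarrow> nat) \<Rightarrow> nat \<Rightarrow> nat" where
  "inverse_tuple n p = restrict (inv_into {1..n} p) {1..n}"

definition glued_products :: "nat \<Rightarrow> ((nat \<Rightarrow> nat) + (nat \<Rightarrow> nat)) set pair_pre_digraph" where
  "glued_products n =
     identify_verts
       (disjoint_union (cart_power (complete_graph n) n) (cart_power (complete_graph n) n))
       {(Inl p, Inr (inverse_tuple n p)) |p. permutation_vertex n p}"

end

theory Submission
  imports Defs
begin

text \<open>
  A set of cells of the \<open>n \<times> n\<close> board dominates the rook graph iff it meets every row or every
  column, since a cell whose row and column are both missed is not dominated. Hence the minimal
  dominating sets are the transversals of the rows and the transversals of the columns, i.e. the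
  graphs of functions from rows to columns and from columns to rows; the sets of both kinds are the
  graphs of permutations. All of them have \<open>n\<close> cells, so a reconfiguration step moves one
  cell to an adjacent cell. A move inside a row forces both sets to be row transversals (a column
  transversal would lose a column), and it changes one entry of the tuple; dually for columns.
\<close>

section \<open>Quotients given by the fibres of a map\<close>

text \<open>If the classes are exactly the fibres of \<open>h\<close>, sending each point of
  \<open>H\<close> to its fibre is the isomorphism. The condition \<open>h u \<noteq> h v\<close>
  mirrors the removal of loops in \<open>identify_verts\<close>.\<close>

lemma digraph_iso_identify_verts:
  fixes h :: "'a \<Rightarrow> 'b"
  assumes fibres: "\<And>u. u \<in> pverts G \<Longrightarrow> (r \<union> r\<inverse>)\<^sup>* `` {u} = {v \<in> pverts G. h v = h u}"
    and wf: "parcs G \<subseteq> pverts G \<times> pverts G"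
    and verts: "pverts H = h ` pverts G"
    and arcs: "parcs H = {(h u, h v) |u v. (u, v) \<in> parcs G \<and> h u \<noteq> h v}"
  shows "digraph_iso (with_proj H) (with_proj (identify_verts G r))"
proof -
  define \<phi> where "\<phi> = (\<lambda>x. {v \<in> pverts G. h v = x})"
  \<comment> \<open>In \<open>with_proj\<close> an arc is a pair of vertices, so it is mapped
    componentwise and its ends are the two projections.\<close>
  define iso where
    "iso = \<lparr> iso_verts = \<phi>, iso_arcs = map_prod \<phi> \<phi>, iso_head = snd, iso_tail = fst \<rparr>"
  have class_eq: "(r \<union> r\<inverse>)\<^sup>* `` {u} = \<phi> (h u)" if "u \<in> pverts G" for u
    using fibres[OF that] by (simp add: \<phi>_def)
  \<comment> \<open>Fibres over points of the image are nonempty, so different points have different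
    fibres.\<close>
  have inj: "inj_on \<phi> (pverts H)"
    unfolding verts \<phi>_def by (intro inj_onI) blast
  have arcs_sub: "parcs H \<subseteq> pverts H \<times> pverts H"
    using wf by (auto simp: verts arcs)
  have "inj_on (map_prod \<phi> \<phi>) (parcs H)"
    using map_prod_inj_on[OF inj inj] arcs_sub by (rule inj_on_subset)
  moreover have "wf_digraph (with_proj H)"
    using arcs_sub by unfold_locales auto
  ultimately have "pre_digraph.digraph_isomorphism (with_proj H) iso"
    using inj by (simp add: pre_digraph.digraph_isomorphism_def iso_def)
  moreover have "with_proj (identify_verts G r) = app_iso iso (with_proj H)"
  proof -
    have "pverts G // (r \<union> r\<inverse>)\<^sup>* = \<phi> ` pverts H"
      unfolding quotient_def verts using class_eq by auto
    moreover have "{((r \<union> r\<inverse>)\<^sup>* `` {u}, (r \<union> r\<inverse>)\<^sup>* `` {v}) |u v.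
        (u, v) \<in> parcs G \<and> (r \<union> r\<inverse>)\<^sup>* `` {u} \<noteq> (r \<union> r\<inverse>)\<^sup>* `` {v}} = map_prod \<phi> \<phi> ` parcs H"
      (is "?L = ?R")
    proof -
      have "?L = {(\<phi> (h u), \<phi> (h v)) |u v. (u, v) \<in> parcs G \<and> \<phi> (h u) \<noteq> \<phi> (h v)}"
        by (intro Collect_cong ex_cong1) (metis (no_types, lifting) class_eq wf mem_Sigma_iff subsetD)
      also have "\<dots> = {(\<phi> (h u), \<phi> (h v)) |u v. (u, v) \<in> parcs G \<and> h u \<noteq> h v}"
      proof -
        have "\<phi> (h u) = \<phi> (h v) \<longleftrightarrow> h u = h v" if "(u, v) \<in> parcs G" for u v
          using that wf inj_on_eq_iff[OF inj] by (auto simp: verts)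
        then show ?thesis by (intro Collect_cong ex_cong1) auto
      qed
      also have "\<dots> = ?R"
        unfolding arcs by (auto simp: image_iff)
      finally show ?thesis .
    qed
    ultimately show ?thesis
      by (simp add: identify_verts_def app_iso_def iso_def with_proj_def)
  qed
  ultimately show ?thesis
    unfolding digraph_iso_def by blast
qed

section \<open>Minimal dominating sets of the rook graph\<close>

abbreviation rook_graph :: "nat \<Rightarrow> (nat \<times> nat) pair_pre_digraph" where
  "rook_graph n \<equiv> complete_graph n \<box> complete_graph n"

abbreviation tuples :: "nat \<Rightarrow> (nat \<Rightarrow> nat) set" where
  "tuples n \<equiv> {1..n} \<rightarrow>\<^sub>E {1..n}"

definition row_set :: "nat \<Rightarrow> (nat \<Rightarrow> nat) \<Rightarrow> (nat \<times> nat) set" where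
  "row_set n f = (\<lambda>i. (i, f i)) ` {1..n}"

text \<open>Defined as a mirror image, so that facts on rows pass to columns by reflection in the
  diagonal.\<close>

definition col_set :: "nat \<Rightarrow> (nat \<Rightarrow> nat) \<Rightarrow> (nat \<times> nat) set" where
  "col_set n g = prod.swap ` row_set n g"

lemma mem_row_set [simp]: "(i, j) \<in> row_set n f \<longleftrightarrow> i \<in> {1..n} \<and> j = f i"
  by (auto simp: row_set_def)

lemma mem_col_set [simp]: "(i, j) \<in> col_set n g \<longleftrightarrow> j \<in> {1..n} \<and> i = g j"
  by (auto simp: col_set_def row_set_def image_iff)

lemma finite_row_set [simp]: "finite (row_set n f)"
  by (simp add: row_set_def)

lemma card_row_set: "card (row_set n f) = n"
  unfolding row_set_def by (subst card_image) (auto intro: inj_onI)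

lemma finite_col_set [simp]: "finite (col_set n g)"
  by (simp add: col_set_def)

lemma card_col_set: "card (col_set n g) = n"
  by (simp add: col_set_def card_image card_row_set)

text \<open>The set only records values on \<open>{1..n}\<close>; extensionality of tuples settles
  the other arguments.\<close>

lemma row_set_inject: "f \<in> tuples n \<Longrightarrow> g \<in> tuples n \<Longrightarrow> row_set n f = row_set n g \<longleftrightarrow> f = g"
  by (metis PiE_ext mem_row_set)

lemma col_set_inject: "f \<in> tuples n \<Longrightarrow> g \<in> tuples n \<Longrightarrow> col_set n f = col_set n g \<longleftrightarrow> f = g"
  by (metis PiE_ext mem_col_set)

lemma rook_graph_verts: "pverts (rook_graph n) = {1..n} \<times> {1..n}"
  by (simp add: cart_prod_def complete_graph_def)

lemma rook_graph_arcs: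
  "((a, b), (a', b')) \<in> parcs (rook_graph n) \<longleftrightarrow>
     {a, b, a', b'} \<subseteq> {1..n} \<and> (a = a' \<and> b \<noteq> b' \<or> b = b' \<and> a \<noteq> a')"
  by (auto simp: cart_prod_def complete_graph_def)

lemma dominating_set_rook_graph:
  "dominating_set (rook_graph n) S \<longleftrightarrow>
     S \<subseteq> {1..n} \<times> {1..n} \<and> ({1..n} \<subseteq> fst ` S \<or> {1..n} \<subseteq> snd ` S)"
proof (cases "S \<subseteq> {1..n} \<times> {1..n}")
  case True
  have dom: "(v \<in> S \<or> (\<exists>u\<in>S. (u, v) \<in> parcs (rook_graph n))) \<longleftrightarrow>
      fst v \<in> fst ` S \<or> snd v \<in> snd ` S" (is "?L \<longleftrightarrow> ?R")
    if "v \<in> {1..n} \<times> {1..n}" for v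
  proof
    assume ?L
    then show ?R by (cases v) (force simp: rook_graph_arcs)
  next
    assume ?R
    then obtain u where u: "u \<in> S" "fst u = fst v \<or> snd u = snd v" by auto
    then have "u = v \<or> (u, v) \<in> parcs (rook_graph n)"
      using True that by (cases u; cases v) (auto simp: rook_graph_arcs)
    with u show ?L by blast
  qed
  have "dominating_set (rook_graph n) S \<longleftrightarrow>
      (\<forall>v\<in>{1..n} \<times> {1..n}. fst v \<in> fst ` S \<or> snd v \<in> snd ` S)"
    using True dom by (simp add: dominating_set_def rook_graph_verts)
  \<comment> \<open>The two coordinates range independently, so the universal quantifier distributes
    over the disjunction.\<close>
  also have "\<dots> \<longleftrightarrow> {1..n} \<subseteq> fst ` S \<or> {1..n} \<subseteq> snd ` S"
    by (auto simp: subset_iff Ball_def simp del: atLeastAtMost_iff)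
  finally show ?thesis using True by simp
qed (simp add: dominating_set_def rook_graph_verts)

lemma row_set_dominating: "f \<in> tuples n \<Longrightarrow> dominating_set (rook_graph n) (row_set n f)"
  by (force simp: dominating_set_rook_graph row_set_def image_image)

lemma col_set_dominating: "g \<in> tuples n \<Longrightarrow> dominating_set (rook_graph n) (col_set n g)"
  by (force simp: dominating_set_rook_graph col_set_def row_set_def image_image)

lemma dominating_set_contains_transversal:
  assumes "dominating_set (rook_graph n) S"
  shows "\<exists>f\<in>tuples n. row_set n f \<subseteq> S \<or> col_set n f \<subseteq> S"
proof -
  have sub: "S \<subseteq> {1..n} \<times> {1..n}" and "{1..n} \<subseteq> fst ` S \<or> {1..n} \<subseteq> snd ` S"
    using assms by (auto simp: dominating_set_rook_graph)
  then consider "\<forall>i\<in>{1..n}. \<exists>j. (i, j) \<in> S" | "\<forall>j\<in>{1..n}. \<exists>i. (i, j) \<in> S"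
    by (fastforce simp del: atLeastAtMost_iff)
  then show ?thesis
  proof cases
    case 1
    then obtain f where f: "\<And>i. i \<in> {1..n} \<Longrightarrow> (i, f i) \<in> S" by metis
    \<comment> \<open>The choice function is arbitrary outside \<open>{1..n}\<close>; restricting it
      makes it extensional.\<close>
    have "restrict f {1..n} \<in> tuples n" using f sub by fastforce
    moreover have "row_set n (restrict f {1..n}) \<subseteq> S"
      using f by (auto simp: row_set_def)
    ultimately show ?thesis by blast
  next
    case 2
    then obtain f where f: "\<And>i. i \<in> {1..n} \<Longrightarrow> (f i, i) \<in> S" by metis
    have "restrict f {1..n} \<in> tuples n" using f sub by fastforce
    moreover have "col_set n (restrict f {1..n}) \<subseteq> S"
      using f by (auto simp: col_set_def row_set_def)
    ultimately show ?thesis by blast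
  qed
qed

lemma card_dominating_set:
  assumes "dominating_set (rook_graph n) S"
  shows "n \<le> card S"
proof -
  have "finite S"
    using assms finite_subset[of S "{1..n} \<times> {1..n}"] by (simp add: dominating_set_rook_graph)
  then show ?thesis
    using dominating_set_contains_transversal[OF assms] card_mono[of S]
    by (metis card_row_set card_col_set)
qed

text \<open>A transversal inside \<open>M\<close> already dominates, so minimality forces equality.
  Conversely, a proper subset of a transversal has fewer than \<open>n\<close> cells, too few by
  \<open>card_dominating_set\<close>.\<close>

lemma minimal_dominating_set_rook_graph:
  "minimal_dominating_set (rook_graph n) M \<longleftrightarrow> (\<exists>f\<in>tuples n. M = row_set n f \<or> M = col_set n f)"
proof
  assume M: "minimal_dominating_set (rook_graph n) M"
  then obtain f where "f \<in> tuples n" "row_set n f \<subseteq> M \<or> col_set n f \<subseteq> M"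
    using dominating_set_contains_transversal[of n M] unfolding minimal_dominating_set_def by blast
  then show "\<exists>f\<in>tuples n. M = row_set n f \<or> M = col_set n f"
    using M row_set_dominating col_set_dominating
    by (metis minimal_dominating_set_def psubsetI)
next
  assume "\<exists>f\<in>tuples n. M = row_set n f \<or> M = col_set n f"
  then have "dominating_set (rook_graph n) M" "finite M" "card M = n"
    by (auto simp: row_set_dominating col_set_dominating card_row_set card_col_set)
  then show "minimal_dominating_set (rook_graph n) M"
    unfolding minimal_dominating_set_def
    by (metis card_dominating_set linorder_not_le psubset_card_mono)
qed

section \<open>Reconfiguration steps\<close>

text \<open>In general a step trades one vertex for a set of its neighbours. Equal cardinalities
  make both differences equally large, so when one is a singleton the other is too.\<close>

lemma adjacent_iff_exchange:
  assumes "finite M1" "finite M2" "card M1 = card M2"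
  shows "(\<exists>v. (M2 - M1 = {v} \<and> M1 - M2 \<subseteq> neighbourhood (rook_graph n) v) \<or>
              (M1 - M2 = {v} \<and> M2 - M1 \<subseteq> neighbourhood (rook_graph n) v)) \<longleftrightarrow>
         (\<exists>u v. M1 - M2 = {u} \<and> M2 - M1 = {v} \<and> (u, v) \<in> parcs (rook_graph n))"
proof -
  have "card (M1 - M2) = card (M2 - M1)"
    using assms by (simp add: card_Diff_subset_Int Int_commute)
  then have single: "(\<exists>u. M1 - M2 = {u}) \<longleftrightarrow> (\<exists>v. M2 - M1 = {v})"
    by (metis card_1_singleton_iff One_nat_def)
  have sym: "(u, v) \<in> parcs (rook_graph n) \<longleftrightarrow> (v, u) \<in> parcs (rook_graph n)" for u v
    by (cases u; cases v) (auto simp: rook_graph_arcs)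
  show ?thesis
    using single sym unfolding neighbourhood_def by (smt (verit) insert_subset empty_subsetI mem_Collect_eq)
qed

lemma row_set_exchange:
  assumes "(f, g) \<in> parcs (cart_power (complete_graph n) n)"
  shows "\<exists>i a b. row_set n f - row_set n g = {(i, a)} \<and> row_set n g - row_set n f = {(i, b)} \<and>
    ((i, a), (i, b)) \<in> parcs (rook_graph n)"
proof -
  obtain i where i: "i \<in> {1..n}" "f i \<noteq> g i" "\<And>j. j \<in> {1..n} \<Longrightarrow> j \<noteq> i \<Longrightarrow> f j = g j"
    and fg: "f \<in> tuples n" "g \<in> tuples n"
    using assms unfolding cart_power_complete_graph_arcs by metis
  have "row_set n f - row_set n g = {(i, f i)}" "row_set n g - row_set n f = {(i, g i)}"
    using i by (auto simp del: atLeastAtMost_iff) metis+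
  moreover have "((i, f i), (i, g i)) \<in> parcs (rook_graph n)"
    using i fg PiE_mem[OF fg(1) i(1)] PiE_mem[OF fg(2) i(1)] by (simp add: rook_graph_arcs)
  ultimately show ?thesis by blast
qed

text \<open>Nothing is assumed about the shape of \<open>M\<close>: replacing a cell of a row
  transversal within its row leaves exactly one cell in every row. Both arc directions are stated
  because the known row transversal may be either end of a step.\<close>

lemma exchange_row_set:
  assumes f: "f \<in> tuples n"
    and diff: "row_set n f - M = {(i, a)}" "M - row_set n f = {(i, b)}"
    and b: "b \<in> {1..n}"
  shows "\<exists>g\<in>tuples n. M = row_set n g \<and> (f, g) \<in> parcs (cart_power (complete_graph n) n) \<and>
    (g, f) \<in> parcs (cart_power (complete_graph n) n)"
proof -
  have i: "i \<in> {1..n}" "a = f i" using diff(1) by (auto simp: set_eq_iff simp del: atLeastAtMost_iff)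
  have "b \<noteq> f i" using diff i by (metis DiffD2 insertI1 mem_row_set)
  have g: "f(i := b) \<in> tuples n"
    using f b i by (auto simp: PiE_iff extensional_def)
  have "M = row_set n f - {(i, a)} \<union> {(i, b)}" using diff by blast
  also have "\<dots> = row_set n (f(i := b))" using i by (auto split: if_splits)
  finally have "M = row_set n (f(i := b))" .
  moreover have "(f, f(i := b)) \<in> parcs (cart_power (complete_graph n) n)"
    "(f(i := b), f) \<in> parcs (cart_power (complete_graph n) n)"
    using f g i \<open>b \<noteq> f i\<close> by (auto simp: cart_power_complete_graph_arcs)
  ultimately show ?thesis using g by blast
qed

text \<open>If both sets were column transversals, the second one would miss column \<open>a\<close>.\<close>

lemma exchange_in_row:
  assumes M1: "\<exists>f\<in>tuples n. M1 = row_set n f \<or> M1 = col_set n f"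
    and M2: "\<exists>f\<in>tuples n. M2 = row_set n f \<or> M2 = col_set n f"
    and diff: "M1 - M2 = {(i, a)}" "M2 - M1 = {(i, b)}"
    and ab: "a \<in> {1..n}" "b \<in> {1..n}" "a \<noteq> b"
  shows "\<exists>f g. M1 = row_set n f \<and> M2 = row_set n g \<and>
    (f, g) \<in> parcs (cart_power (complete_graph n) n)"
proof -
  \<comment> \<open>One row transversal among the two sets suffices, since
    \<open>exchange_row_set\<close> makes the other one a row transversal as well.\<close>
  consider f where "f \<in> tuples n" "M1 = row_set n f" | f where "f \<in> tuples n" "M2 = row_set n f"
    | f g where "M1 = col_set n f" "M2 = col_set n g"
    using M1 M2 by blast
  then show ?thesis
  proof cases
    case 1
    then show ?thesis using exchange_row_set[of f n M2 i a b] diff ab by blast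
  next
    case 2
    then show ?thesis using exchange_row_set[of f n M1 i b a] diff ab by blast
  next
    case 3
    have "(g a, a) \<in> M2" using 3 ab by simp
    moreover have "(g a, a) \<noteq> (i, b)" using ab by simp
    ultimately have "(g a, a) \<in> M1" using diff by blast
    moreover have "(i, a) \<in> M1" "(i, a) \<notin> M2" using diff by blast+
    ultimately show ?thesis using 3 \<open>(g a, a) \<in> M2\<close> by simp
  qed
qed

lemma swap_image_row_set: "prod.swap ` row_set n f = col_set n f"
  and swap_image_col_set: "prod.swap ` col_set n f = row_set n f"
  by (simp_all add: col_set_def image_image)

text \<open>Reflection in the diagonal turns a move inside a column into a move inside a row and
  exchanges the two kinds of transversals, which reduces the claim to
  \<open>exchange_in_row\<close>.\<close>

lemma exchange_in_col:
  assumes M1: "\<exists>f\<in>tuples n. M1 = row_set n f \<or> M1 = col_set n f"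
    and M2: "\<exists>f\<in>tuples n. M2 = row_set n f \<or> M2 = col_set n f"
    and diff: "M1 - M2 = {(a, i)}" "M2 - M1 = {(b, i)}"
    and ab: "a \<in> {1..n}" "b \<in> {1..n}" "a \<noteq> b"
  shows "\<exists>f g. M1 = col_set n f \<and> M2 = col_set n g \<and>
    (f, g) \<in> parcs (cart_power (complete_graph n) n)"
proof -
  have swap_diff: "prod.swap ` A - prod.swap ` B = prod.swap ` (A - B)" for A B :: "(nat \<times> nat) set"
    by (simp add: image_set_diff)
  have "\<exists>f g. prod.swap ` M1 = row_set n f \<and> prod.swap ` M2 = row_set n g \<and>
    (f, g) \<in> parcs (cart_power (complete_graph n) n)"
  proof (rule exchange_in_row)
    show "\<exists>f\<in>tuples n. prod.swap ` M1 = row_set n f \<or> prod.swap ` M1 = col_set n f"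
      "\<exists>f\<in>tuples n. prod.swap ` M2 = row_set n f \<or> prod.swap ` M2 = col_set n f"
      using M1 M2 swap_image_row_set swap_image_col_set by metis+
    show "prod.swap ` M1 - prod.swap ` M2 = {(i, a)}" "prod.swap ` M2 - prod.swap ` M1 = {(i, b)}"
      using diff by (simp_all add: swap_diff)
  qed (use ab in auto)
  \<comment> \<open>Reflection is an involution, so the equations for the reflected sets can be
    carried back.\<close>
  moreover have "prod.swap ` prod.swap ` M = M" for M :: "(nat \<times> nat) set"
    by (simp add: image_image)
  ultimately show ?thesis by (metis swap_image_row_set)
qed

lemma col_set_exchange:
  assumes "(f, g) \<in> parcs (cart_power (complete_graph n) n)"
  shows "\<exists>i a b. col_set n f - col_set n g = {(a, i)} \<and> col_set n g - col_set n f = {(b, i)} \<and>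
    ((a, i), (b, i)) \<in> parcs (rook_graph n)"
proof -
  have swap_diff: "col_set n f - col_set n g = prod.swap ` (row_set n f - row_set n g)" for f g
    by (simp add: image_set_diff col_set_def)
  obtain i a b where "row_set n f - row_set n g = {(i, a)}" "row_set n g - row_set n f = {(i, b)}"
    "((i, a), (i, b)) \<in> parcs (rook_graph n)"
    using row_set_exchange[OF assms] by blast
  then show ?thesis unfolding swap_diff by (auto simp: rook_graph_arcs)
qed

text \<open>Every step lies within one copy of the product, even when an end is a permutation set
  and so belongs to both: the direction of the move decides how both ends are read.\<close>

lemma reconf_graph_rook_graph_arcs:
  "(M1, M2) \<in> parcs (reconf_graph (rook_graph n)) \<longleftrightarrow>
    (\<exists>f g. (f, g) \<in> parcs (cart_power (complete_graph n) n) \<and>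
      (M1 = row_set n f \<and> M2 = row_set n g \<or> M1 = col_set n f \<and> M2 = col_set n g))"
  (is "_ \<longleftrightarrow> ?R")
proof -
  let ?T = "\<lambda>M. \<exists>f\<in>tuples n. M = row_set n f \<or> M = col_set n f"
  have card_T: "finite M \<and> card M = n" if "?T M" for M
    using that by (auto simp: card_row_set card_col_set)
  have "(M1, M2) \<in> parcs (reconf_graph (rook_graph n)) \<longleftrightarrow> ?T M1 \<and> ?T M2 \<and>
      (\<exists>v. (M2 - M1 = {v} \<and> M1 - M2 \<subseteq> neighbourhood (rook_graph n) v) \<or>
           (M1 - M2 = {v} \<and> M2 - M1 \<subseteq> neighbourhood (rook_graph n) v))"
    by (simp add: reconf_graph_def minimal_dominating_set_rook_graph)
  also have "\<dots> \<longleftrightarrow> ?T M1 \<and> ?T M2 \<and>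
      (\<exists>u v. M1 - M2 = {u} \<and> M2 - M1 = {v} \<and> (u, v) \<in> parcs (rook_graph n))"
    \<comment> \<open>The congruence rule makes \<open>?T M1\<close> and \<open>?T M2\<close>
      available, which give finiteness and the common cardinality \<open>n\<close>.\<close>
    by (intro conj_cong refl adjacent_iff_exchange) (metis card_T)+
  also have "\<dots> \<longleftrightarrow> ?R"
  proof
    assume L: "?T M1 \<and> ?T M2 \<and>
      (\<exists>u v. M1 - M2 = {u} \<and> M2 - M1 = {v} \<and> (u, v) \<in> parcs (rook_graph n))"
    then obtain a b a' b' where d: "M1 - M2 = {(a, b)}" "M2 - M1 = {(a', b')}"
      and e: "((a, b), (a', b')) \<in> parcs (rook_graph n)"
      by auto
    from e consider "a = a'" "b \<noteq> b'" "b \<in> {1..n}" "b' \<in> {1..n}"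
      | "b = b'" "a \<noteq> a'" "a \<in> {1..n}" "a' \<in> {1..n}"
      unfolding rook_graph_arcs by blast
    then show ?R
    proof cases
      case 1
      have "M2 - M1 = {(a, b')}" using d 1 by simp
      from exchange_in_row[OF _ _ d(1) this 1(3,4,2)] L show ?thesis by metis
    next
      case 2
      have "M2 - M1 = {(a', b)}" using d 2 by simp
      from exchange_in_col[OF _ _ d(1) this 2(3,4,2)] L show ?thesis by metis
    qed
  next
    assume ?R
    then obtain f g where fg: "(f, g) \<in> parcs (cart_power (complete_graph n) n)"
      and M: "M1 = row_set n f \<and> M2 = row_set n g \<or> M1 = col_set n f \<and> M2 = col_set n g"
      by blast
    have "f \<in> tuples n" "g \<in> tuples n"
      using fg unfolding cart_power_complete_graph_arcs by blast+
    then show "?T M1 \<and> ?T M2 \<and>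
      (\<exists>u v. M1 - M2 = {u} \<and> M2 - M1 = {v} \<and> (u, v) \<in> parcs (rook_graph n))"
      using M row_set_exchange[OF fg] col_set_exchange[OF fg] by blast
  qed
  finally show ?thesis .
qed

section \<open>The glued products\<close>

text \<open>Equality of the sets says that \<open>j = f i\<close> and \<open>i = g j\<close> are
  equivalent on the board, that is, \<open>f\<close> and \<open>g\<close> are mutually
  inverse.\<close>

lemma row_set_eq_col_set_iff:
  assumes f: "f \<in> tuples n" and g: "g \<in> tuples n"
  shows "row_set n f = col_set n g \<longleftrightarrow> permutation_vertex n f \<and> g = inverse_tuple n f"
proof
  assume eq: "row_set n f = col_set n g"
  have gf: "g (f i) = i" if "i \<in> {1..n}" for i
    using eq that by (metis mem_col_set mem_row_set)
  have fg: "g j \<in> {1..n} \<and> f (g j) = j" if "j \<in> {1..n}" for j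
    using eq that by (metis mem_col_set mem_row_set)
  have inj: "inj_on f {1..n}" using gf by (metis inj_onI)
  have "f ` {1..n} = {1..n}"
  proof
    show "f ` {1..n} \<subseteq> {1..n}" using f by blast
    show "{1..n} \<subseteq> f ` {1..n}" using fg by (metis imageI subsetI)
  qed
  moreover have "g = inverse_tuple n f"
  proof (rule PiE_ext[OF g])
    show "inverse_tuple n f \<in> {1..n} \<rightarrow>\<^sub>E {1..n}"
      using \<open>f ` {1..n} = {1..n}\<close> by (auto simp: inverse_tuple_def inv_into_into simp del: atLeastAtMost_iff)
    fix j assume "j \<in> {1..n}"
    then show "g j = inverse_tuple n f j"
      using fg[of j] inv_into_f_eq[OF inj, of "g j" j]
      by (simp add: inverse_tuple_def del: atLeastAtMost_iff)
  qed
  ultimately show "permutation_vertex n f \<and> g = inverse_tuple n f"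
    using f by (simp add: permutation_vertex_def)
next
  assume a: "permutation_vertex n f \<and> g = inverse_tuple n f"
  then have im: "f ` {1..n} = {1..n}" by (simp add: permutation_vertex_def)
  \<comment> \<open>A surjection of a finite set onto itself is injective.\<close>
  then have "inj_on f {1..n}" by (simp add: eq_card_imp_inj_on)
  then have "g (f i) = i" if "i \<in> {1..n}" for i
    using a that PiE_mem[OF f that] by (simp add: inverse_tuple_def del: atLeastAtMost_iff)
  \<comment> \<open>One inclusion is enough, because both sets have \<open>n\<close> cells.\<close>
  then have "row_set n f \<subseteq> col_set n g"
    using PiE_mem[OF f] by (auto simp: row_set_def simp del: atLeastAtMost_iff)
  then show "row_set n f = col_set n g"
    by (simp add: card_subset_eq card_row_set card_col_set)
qed

lemma inverse_tuple_mem: "permutation_vertex n p \<Longrightarrow> inverse_tuple n p \<in> tuples n"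
  by (auto simp: permutation_vertex_def inverse_tuple_def inv_into_into simp del: atLeastAtMost_iff)

text \<open>The map on both copies whose fibres turn out to be the glueing classes.\<close>

definition tuple_set :: "nat \<Rightarrow> (nat \<Rightarrow> nat) + (nat \<Rightarrow> nat) \<Rightarrow> (nat \<times> nat) set" where
  "tuple_set n = case_sum (row_set n) (col_set n)"

text \<open>\<open>tuple_set\<close> is constant along \<open>r\<close>, hence on classes.
  Conversely, it is injective on each copy, so two different vertices with the same set lie in
  different copies and are already related by a single pair of \<open>r\<close>.\<close>

lemma glueing_classes:
  fixes n :: nat
  defines "r \<equiv> {(Inl p, Inr (inverse_tuple n p)) |p. permutation_vertex n p}"
    and "V \<equiv> Inl ` tuples n \<union> Inr ` tuples n"
  assumes u: "u \<in> V"
  shows "(r \<union> r\<inverse>)\<^sup>* `` {u} = {v \<in> V. tuple_set n v = tuple_set n u}"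
proof (intro equalityI subsetI)
  have r: "x \<in> V \<and> y \<in> V \<and> tuple_set n x = tuple_set n y" if xy: "(x, y) \<in> r" for x y
  proof -
    obtain p where p: "permutation_vertex n p" "x = Inl p" "y = Inr (inverse_tuple n p)"
      using xy unfolding r_def by blast
    moreover have "p \<in> tuples n" using p(1) by (simp add: permutation_vertex_def)
    ultimately show ?thesis
      using inverse_tuple_mem[OF p(1)] row_set_eq_col_set_iff[of p n "inverse_tuple n p"]
      by (simp add: V_def tuple_set_def)
  qed
  fix v assume "v \<in> (r \<union> r\<inverse>)\<^sup>* `` {u}"
  then have "(u, v) \<in> (r \<union> r\<inverse>)\<^sup>*" by simp
  then show "v \<in> {v \<in> V. tuple_set n v = tuple_set n u}"
    by induction (use u r in auto)
next
  fix v assume "v \<in> {v \<in> V. tuple_set n v = tuple_set n u}"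
  then have v: "v \<in> V" "tuple_set n u = tuple_set n v" by auto
  have rI: "(Inl f, Inr g) \<in> r" if "f \<in> tuples n" "g \<in> tuples n" "row_set n f = col_set n g" for f g
    using row_set_eq_col_set_iff[OF that(1,2)] that(3) by (auto simp: r_def)
  \<comment> \<open>Vertices of the same copy are equal by injectivity; for different copies, the
    direction of the pair depends on which vertex is in the first copy.\<close>
  have "u = v \<or> (u, v) \<in> r \<or> (v, u) \<in> r"
    using u v rI row_set_inject col_set_inject unfolding V_def
    by (elim UnE imageE) (simp_all add: tuple_set_def)
  then show "v \<in> (r \<union> r\<inverse>)\<^sup>* `` {u}" by auto
qed

theorem theorem7:
  fixes n :: nat
  assumes "n > 0"
  shows "digraph_iso (with_proj (reconf_graph (complete_graph n \<box> complete_graph n)))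
                     (with_proj (glued_products n))"
  unfolding glued_products_def
proof (rule digraph_iso_identify_verts)
  let ?P = "cart_power (complete_graph n) n"
  let ?D = "disjoint_union ?P ?P"
  have power_verts: "pverts ?P = tuples n"
    by (simp add: cart_power_def complete_graph_def)
  have verts: "pverts ?D = Inl ` tuples n \<union> Inr ` tuples n"
    by (simp add: disjoint_union_def power_verts)
  \<comment> \<open>This goal fixes the map \<open>h\<close> of the quotient lemma as
    \<open>tuple_set n\<close>.\<close>
  show "({(Inl p, Inr (inverse_tuple n p)) |p. permutation_vertex n p} \<union>
      {(Inl p, Inr (inverse_tuple n p)) |p. permutation_vertex n p}\<inverse>)\<^sup>* `` {u} =
      {v \<in> pverts ?D. tuple_set n v = tuple_set n u}" if "u \<in> pverts ?D" for u
    using that unfolding verts by (rule glueing_classes)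
  have wf: "f \<in> tuples n \<and> g \<in> tuples n" if "(f, g) \<in> parcs ?P" for f g
    using that by (simp add: cart_power_complete_graph_arcs)
  then show "parcs ?D \<subseteq> pverts ?D \<times> pverts ?D"
    unfolding verts by (auto simp: disjoint_union_def)
  show "pverts (reconf_graph (rook_graph n)) = tuple_set n ` pverts ?D"
    unfolding verts
    by (auto simp: reconf_graph_def minimal_dominating_set_rook_graph tuple_set_def image_Un image_image)
  \<comment> \<open>Adjacent tuples of one copy differ and hence give different sets, so no arc
    collapses to a loop under the identification.\<close>
  have neq: "row_set n f \<noteq> row_set n g \<and> col_set n f \<noteq> col_set n g" if "(f, g) \<in> parcs ?P" for f g
    using that wf[OF that] by (auto simp: cart_power_complete_graph_arcs row_set_inject col_set_inject)
  have D_arcs: "(u, v) \<in> parcs ?D \<longleftrightarrow>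
      (\<exists>f g. (f, g) \<in> parcs ?P \<and> (u = Inl f \<and> v = Inl g \<or> u = Inr f \<and> v = Inr g))" for u v
    by (auto simp: disjoint_union_def)
  have tuple_set_simps: "tuple_set n (Inl f) = row_set n f" "tuple_set n (Inr f) = col_set n f" for f
    by (simp_all add: tuple_set_def)
  show "parcs (reconf_graph (rook_graph n)) =
      {(tuple_set n u, tuple_set n v) |u v. (u, v) \<in> parcs ?D \<and> tuple_set n u \<noteq> tuple_set n v}"
    (is "?L = ?R")
  proof (intro equalityI subrelI)
    fix M1 M2 assume "(M1, M2) \<in> ?L"
    then obtain f g where fg: "(f, g) \<in> parcs ?P"
      "M1 = row_set n f \<and> M2 = row_set n g \<or> M1 = col_set n f \<and> M2 = col_set n g"
      unfolding reconf_graph_rook_graph_arcs by blast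
    have "(Inl f, Inl g) \<in> parcs ?D" "(Inr f, Inr g) \<in> parcs ?D"
      using fg(1) unfolding D_arcs by blast+
    then show "(M1, M2) \<in> ?R"
      using fg(2) neq[OF fg(1)] tuple_set_simps by blast
  next
    fix M1 M2 assume "(M1, M2) \<in> ?R"
    then obtain u v where uv: "M1 = tuple_set n u" "M2 = tuple_set n v" "(u, v) \<in> parcs ?D"
      by blast
    then obtain f g where "(f, g) \<in> parcs ?P" "u = Inl f \<and> v = Inl g \<or> u = Inr f \<and> v = Inr g"
      unfolding D_arcs by blast
    then show "(M1, M2) \<in> ?L"
      unfolding reconf_graph_rook_graph_arcs uv by (metis tuple_set_simps)
  qed
qed

end
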